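(* Let $n\ge 1$ and $1\le k\le n^2$ be integers and let $K$ be any field. Let $R=K[x_{11},\dots,x_{nn},y_{11},\dots,y_{nn}]$ be the polynomial ring in the $2n^2$ variables $x_{ij},y_{ij}$ ($1\le i,j\le n$), with the $\mathbb{N}^2$-grading in which every $x_{ij}$ has degree $(1,0)$ and every $y_{ij}$ has degree $(0,1)$. Let $I\subset R$ be the ideal generated by the squares of all the variables together with $$\{x_{ij}y_{lm}\mid \text{a queen can move from square }(i,j)\text{ to square }(l,m)\}.$$ Let $\mathrm{HF}_{R/I}(a,b)=\dim_K (R/I)_{(a,b)}$, let $\mu(k)=\max\{\mu\in\mathbb{N}\mid \dim_K (R/I)_{(k,\mu)}>0\}$, and let $\Phi(k,u)$ be the number of ways to place $k$ queens on the $n\times n$ chessboard so that there are exactly $u$ unattacked squares. Then for any $0\le u\le\mu(k)$, $$\Phi(k,u)=\mathrm{HF}_{R/I}(k,u)-\sum_{v=u+1}^{\mu(k)}\binom{v}{u}\Phi(k,v).$$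
   Context: The squares of the $n\times n$ chessboard are identified with the pairs $(i,j)$, $1\le i,j\le n$. A queen can move from $(i,j)$ to $(l,m)$ if and only if $(i,j)\ne(l,m)$ and the two squares lie in the same row ($i=l$), the same column ($j=m$), or the same diagonal ($|i-l|=|j-m|$). Placing $k$ queens on the board means choosing a set of $k$ distinct squares (queens are indistinguishable); placements are counted as such sets, with no identification under symmetries of the board. A square $(l,m)$ of the board is unattacked by such a placement if no placed queen, located at $(i,j)$ say, can move from $(i,j)$ to $(l,m)$, that is, if no placed queen is located at a square $(i,j)\ne(l,m)$ with $i=l$, $j=m$ or $|i-l|=|j-m|$. (In particular, an occupied square is unattacked if none of the other queens can move to it. Blocking by other queens is irrelevant: a square is attacked by some queen with blocking taken into account if and only if it is attacked by some queen without.) $\mathbb{N}$ includes $0$. Since $I$ is a monomial ideal, $R/I$ inherits the $\mathbb{N}^2$-grading, and $(R/I)_{(a,b)}$ denotes its homogeneous component of degree $(a,b)$, a finite-dimensional $K$-vector space. *)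

theory Defs
  imports
    "HOL-Library.Poly_Mapping"
    "HOL-Algebra.QuotRing"
    "HOL-Algebra.Embedded_Algebras"
begin

subsection \<open>Queens on the chessboard\<close>

type_synonym square = "nat \<times> nat"

definition board :: "nat \<Rightarrow> square set" where
  "board n = {1..n} \<times> {1..n}"

definition queen_move :: "square \<Rightarrow> square \<Rightarrow> bool" where
  "queen_move s t \<longleftrightarrow> s \<noteq> t \<and>
     (fst s = fst t \<or> snd s = snd t \<or>
      \<bar>int (fst s) - int (fst t)\<bar> = \<bar>int (snd s) - int (snd t)\<bar>)"

definition unattacked :: "nat \<Rightarrow> square set \<Rightarrow> square set" where
  "unattacked n Q = {t \<in> board n. \<not> (\<exists>s\<in>Q. queen_move s t)}"

definition Phi :: "nat \<Rightarrow> nat \<Rightarrow> nat \<Rightarrow> nat" where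
  "Phi n k u = card {Q. Q \<subseteq> board n \<and> card Q = k \<and> card (unattacked n Q) = u}"

subsection \<open>The polynomial ring\<close>

datatype var = XV square | YV square

type_synonym monomial = "var \<Rightarrow>\<^sub>0 nat"

(* Finitely supported maps from exponent vectors to coefficients, with the convolution product
   of Poly_Mapping. The type has variables for all pairs of naturals; the ring of the n x n board
   is cut out by its carrier. *)
type_synonym 'k mpoly = "monomial \<Rightarrow>\<^sub>0 'k"

definition vars :: "nat \<Rightarrow> var set" where
  "vars n = XV ` board n \<union> YV ` board n"

definition poly_ring :: "nat \<Rightarrow> 'k::field mpoly ring" where
  "poly_ring n =
     \<lparr>carrier = {p. \<forall>t \<in> Poly_Mapping.keys p. Poly_Mapping.keys t \<subseteq> vars n},
      mult = (*), one = 1, zero = 0, add = (+)\<rparr>"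

definition Var :: "var \<Rightarrow> 'k::field mpoly" where
  "Var v = Poly_Mapping.single (Poly_Mapping.single v 1) 1"

definition Const :: "'k::field \<Rightarrow> 'k mpoly" where
  "Const c = Poly_Mapping.single 0 c"

definition bidegree :: "nat \<Rightarrow> monomial \<Rightarrow> nat \<times> nat" where
  "bidegree n t = (\<Sum>s\<in>board n. Poly_Mapping.lookup t (XV s), \<Sum>s\<in>board n. Poly_Mapping.lookup t (YV s))"

definition homogeneous :: "nat \<Rightarrow> nat \<times> nat \<Rightarrow> 'k::field mpoly set" where
  "homogeneous n d = {p \<in> carrier (poly_ring n). \<forall>t \<in> Poly_Mapping.keys p. bidegree n t = d}"

subsection \<open>The ideal and the Hilbert function of the quotient\<close>

definition queen_ideal :: "nat \<Rightarrow> 'k::field mpoly set" where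
  "queen_ideal n = Idl\<^bsub>poly_ring n\<^esub>
     ({Var v ^ 2 | v. v \<in> vars n} \<union>
      {Var (XV s) * Var (YV t) | s t. s \<in> board n \<and> t \<in> board n \<and> queen_move s t})"

definition queen_quot :: "nat \<Rightarrow> 'k::field mpoly set ring" where
  "queen_quot n = poly_ring n Quot queen_ideal n"

definition residue :: "nat \<Rightarrow> 'k::field mpoly \<Rightarrow> 'k mpoly set" where
  "residue n p = queen_ideal n +>\<^bsub>poly_ring n\<^esub> p"

(* The generators have no constant term, so c -> residue n (Const c) is injective and its range
   is a subfield of the quotient ring isomorphic to 'k; this embedded copy of 'k provides the
   scalars for dim in HOL-Algebra.Embedded_Algebras. *)
definition HF :: "'k::field itself \<Rightarrow> nat \<Rightarrow> nat \<Rightarrow> nat \<Rightarrow> nat" where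
  "HF _ n a b = ring.dim (queen_quot n)
     (range (\<lambda>c :: 'k. residue n (Const c))) (residue n ` homogeneous n (a, b))"

(* For k <= n^2 the set contains 0 and is bounded by n^2, since R/I vanishes in degrees
   with a component above n^2. *)
definition mu :: "'k::field itself \<Rightarrow> nat \<Rightarrow> nat \<Rightarrow> nat" where
  "mu K n k = Max {m. HF K n k m > 0}"

end

theory Submission
  imports Defs
begin

text \<open>
  The ideal is generated by monomials, so a polynomial lies in it exactly when each of its
  monomials is divisible by a generator (lemma \<open>queen_ideal_eq\<close>), and the remaining monomials,
  here called standard, give a basis of the quotient. The Hilbert function in bidegree \<open>(k, u)\<close>
  is therefore the number of standard monomials of that bidegree
  (lemma \<open>HF_eq_card_if_finite\<close>).

  Since the squares of the variables are in the ideal, a standard monomial is a product of distinct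
  \<open>x\<^sub>s\<close> with \<open>s\<close> in a set \<open>Q\<close> of squares and distinct \<open>y\<^sub>t\<close> with \<open>t\<close> in a set \<open>U\<close>. The mixed
  generators say that no queen on \<open>Q\<close> can move to a square of \<open>U\<close>, that is, \<open>U\<close> consists of
  squares unattacked by \<open>Q\<close>. A square may belong to both \<open>Q\<close> and \<open>U\<close>: a queen cannot move to her
  own square, so \<open>x\<^sub>s y\<^sub>s\<close> is standard, just as an occupied square may count as unattacked.
  Choosing \<open>Q\<close> first and then \<open>u\<close> of its unattacked squares, and sorting the placements by the
  number \<open>v\<close> of unattacked squares, gives \<open>HF(k, u) = \<Sum>\<^sub>v (v choose u) \<Phi>(k, v)\<close>
  (lemma \<open>HF_eq_sum_Phi\<close>).

  In this sum the terms with \<open>v < u\<close> vanish and \<open>\<Phi>(k, u)\<close> has coefficient 1. The sum may stop at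
  \<open>\<mu>(k)\<close>, because a placement with \<open>v\<close> unattacked squares contributes to \<open>HF(k, v)\<close>
  (lemma \<open>Phi_eq_0_above_mu\<close>). Solving for \<open>\<Phi>(k, u)\<close> is the claim.
\<close>

section \<open>The polynomial ring\<close>

lemma carrier_poly_ring:
  "p \<in> carrier (poly_ring n) \<longleftrightarrow> (\<forall>t\<in>Poly_Mapping.keys p. Poly_Mapping.keys t \<subseteq> vars n)"
  by (simp add: poly_ring_def)

lemma poly_ring_simps [simp]:
  "mult (poly_ring n) = (*)" "one (poly_ring n) = 1"
  "zero (poly_ring n) = 0" "add (poly_ring n) = (+)"
  by (simp_all add: poly_ring_def)

lemma poly_ring_add_closed:
  "p \<in> carrier (poly_ring n) \<Longrightarrow> q \<in> carrier (poly_ring n) \<Longrightarrow> p + q \<in> carrier (poly_ring n)"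
  using keys_add[of p q] by (auto simp: carrier_poly_ring)

lemma poly_ring_uminus_closed:
  "p \<in> carrier (poly_ring n) \<Longrightarrow> - p \<in> carrier (poly_ring n)"
  by (auto simp: carrier_poly_ring in_keys_iff)

lemma poly_ring_mult_closed:
  fixes p q :: "'k::field mpoly"
  assumes "p \<in> carrier (poly_ring n)" "q \<in> carrier (poly_ring n)"
  shows "p * q \<in> carrier (poly_ring n)"
  unfolding carrier_poly_ring
proof
  fix t assume "t \<in> Poly_Mapping.keys (p * q)"
  then obtain a b where "t = a + b" "a \<in> Poly_Mapping.keys p" "b \<in> Poly_Mapping.keys q"
    using keys_mult[of p q] by blast
  then show "Poly_Mapping.keys t \<subseteq> vars n"
    using assms keys_add[of a b] by (fastforce simp: carrier_poly_ring)
qed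

lemma cring_poly_ring: "cring (poly_ring n :: 'k::field mpoly ring)"
proof (rule cringI)
  show "abelian_group (poly_ring n :: 'k mpoly ring)"
  proof (rule abelian_groupI)
    fix x :: "'k mpoly" assume "x \<in> carrier (poly_ring n)"
    then show "\<exists>y\<in>carrier (poly_ring n). y \<oplus>\<^bsub>poly_ring n\<^esub> x = \<zero>\<^bsub>poly_ring n\<^esub>"
      by (intro bexI[of _ "- x"]) (auto simp: poly_ring_uminus_closed)
  qed (auto simp: poly_ring_add_closed, auto simp: carrier_poly_ring algebra_simps)
  show "comm_monoid (poly_ring n :: 'k mpoly ring)"
    by (rule comm_monoidI) (auto simp: poly_ring_mult_closed, auto simp: carrier_poly_ring algebra_simps)
qed (auto simp: algebra_simps)

lemma ring_poly_ring: "ring (poly_ring n :: 'k::field mpoly ring)"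
  using cring_poly_ring by (rule cring.axioms)

lemma poly_ring_a_inv:
  assumes "p \<in> carrier (poly_ring n)"
  shows "\<ominus>\<^bsub>poly_ring n\<^esub> p = (- p :: 'k::field mpoly)"
proof -
  interpret ring "poly_ring n :: 'k mpoly ring" by (rule ring_poly_ring)
  show ?thesis
    by (rule minus_equality) (use assms in \<open>auto simp: poly_ring_uminus_closed\<close>)
qed

lemma Const_carrier [simp]: "Const c \<in> carrier (poly_ring n)"
  by (simp add: carrier_poly_ring Const_def)

lemma Const_ring_ops:
  "Const 0 = 0" "Const 1 = 1" "Const (a + b) = Const a + Const b" 
  "Const (- a) = - Const a" "Const (a * b) = Const a * Const b"
  by (simp_all add: Const_def single_add single_uminus mult_single)

text \<open>The copy of the coefficient field in the polynomial ring. Its image in the quotient, which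
  provides the scalars there, inherits the field property along the quotient map.\<close>

lemma subfield_Const: "subfield (range Const) (poly_ring n :: 'k::field mpoly ring)"
proof -
  interpret cring "poly_ring n :: 'k mpoly ring" by (rule cring_poly_ring)
  have subring: "subring (range Const) (poly_ring n :: 'k mpoly ring)"
  proof (rule subringI)
    show "\<one>\<^bsub>poly_ring n\<^esub> \<in> range Const"
      using Const_ring_ops(2) by (metis poly_ring_simps(2) rangeI)
  next
    fix h :: "'k mpoly" assume "h \<in> range Const"
    then obtain c where "h = Const c" ..
    then have "\<ominus>\<^bsub>poly_ring n\<^esub> h = Const (- c)"
      using poly_ring_a_inv[OF Const_carrier] by (simp add: Const_ring_ops)
    then show "\<ominus>\<^bsub>poly_ring n\<^esub> h \<in> range Const" by simp
  qed (auto simp flip: Const_ring_ops)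
  show ?thesis
  proof (rule subfieldI[OF subcringI'[OF subring]])
    have "p \<in> Units (poly_ring n\<lparr>carrier := range Const\<rparr>)" if "p \<in> range Const - {0}" for p :: "'k mpoly"
    proof -
      from that obtain c where c: "p = Const c" by blast
      with that have "c \<noteq> 0" by (auto simp: Const_ring_ops)
      with c have "Const (inverse c) * p = 1"
        by (simp flip: Const_ring_ops)
      with c show ?thesis
        by (auto simp: Units_def mult.commute)
    qed
    then show "Units (poly_ring n\<lparr>carrier := range Const\<rparr>) = range Const - {\<zero>\<^bsub>poly_ring n\<^esub> :: 'k mpoly}"
      by (auto simp: Units_def)
  qed
qed


section \<open>Standard monomials and the ideal\<close>

text \<open>For monomials in the variables of the board, standard means divisible by no generator of the
  queen ideal.\<close>

definition standard :: "monomial \<Rightarrow> bool" where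
  "standard t \<longleftrightarrow> (\<forall>v. Poly_Mapping.lookup t v \<le> 1) \<and>
     (\<forall>r s. XV r \<in> Poly_Mapping.keys t \<longrightarrow> YV s \<in> Poly_Mapping.keys t \<longrightarrow> \<not> queen_move r s)"

lemma standard_divisor: "standard (a + b) \<Longrightarrow> standard a"
  unfolding standard_def
  by (auto simp: lookup_add in_keys_iff) (metis add_leD1)

lemma standard_zero: "standard 0"
  by (simp add: standard_def)

text \<open>This will turn out to be the queen ideal; unlike the generated ideal it has a membership test
  that reads off the monomials.\<close>

definition nonstandard_polys :: "nat \<Rightarrow> 'k::field mpoly set" where
  "nonstandard_polys n = {p \<in> carrier (poly_ring n). \<forall>t\<in>Poly_Mapping.keys p. \<not> standard t}"

text \<open>Closure under products holds because every monomial of a product is a multiple of a monomial of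
  either factor, and multiples of nonstandard monomials are nonstandard.\<close>

lemma ideal_nonstandard_polys: "ideal (nonstandard_polys n) (poly_ring n :: 'k::field mpoly ring)"
proof (rule idealI)
  interpret ring "poly_ring n :: 'k mpoly ring" by (rule ring_poly_ring)
  show "ring (poly_ring n :: 'k mpoly ring)" by (rule ring_poly_ring)
  show "subgroup (nonstandard_polys n) (add_monoid (poly_ring n :: 'k mpoly ring))"
  proof (rule add.subgroupI)
    show "nonstandard_polys n \<subseteq> carrier (poly_ring n :: 'k mpoly ring)"
      by (auto simp: nonstandard_polys_def)
    show "nonstandard_polys n \<noteq> ({} :: 'k mpoly set)"
      by (auto simp: nonstandard_polys_def intro!: exI[of _ 0] simp: carrier_poly_ring)
  next
    fix p :: "'k mpoly" assume "p \<in> nonstandard_polys n"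
    then show "\<ominus>\<^bsub>poly_ring n\<^esub> p \<in> nonstandard_polys n"
      by (auto simp: nonstandard_polys_def poly_ring_a_inv poly_ring_uminus_closed in_keys_iff)
  next
    fix p q :: "'k mpoly" assume "p \<in> nonstandard_polys n" "q \<in> nonstandard_polys n"
    then show "p \<oplus>\<^bsub>poly_ring n\<^esub> q \<in> nonstandard_polys n"
      using keys_add[of p q] by (auto simp: nonstandard_polys_def poly_ring_add_closed)
  qed
  have mult: "p * q \<in> nonstandard_polys n"
    if "p \<in> nonstandard_polys n" "q \<in> carrier (poly_ring n)" for p q :: "'k mpoly"
  proof -
    have "\<not> standard t" if "t \<in> Poly_Mapping.keys (p * q)" for t
      using that keys_mult[of p q] \<open>p \<in> nonstandard_polys n\<close> standard_divisor
      unfolding nonstandard_polys_def by blast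
    then show ?thesis
      using that by (simp add: nonstandard_polys_def poly_ring_mult_closed)
  qed
  fix p q :: "'k mpoly" assume "p \<in> nonstandard_polys n" "q \<in> carrier (poly_ring n)"
  then show "q \<otimes>\<^bsub>poly_ring n\<^esub> p \<in> nonstandard_polys n" "p \<otimes>\<^bsub>poly_ring n\<^esub> q \<in> nonstandard_polys n"
    using mult[of p q] by (simp_all add: mult.commute)
qed

definition restrict_keys :: "monomial set \<Rightarrow> 'k::field mpoly \<Rightarrow> 'k mpoly" where
  "restrict_keys A p = (\<Sum>t\<in>Poly_Mapping.keys p \<inter> A. Poly_Mapping.single t (Poly_Mapping.lookup p t))"

lemma lookup_restrict_keys:
  "Poly_Mapping.lookup (restrict_keys A p) t = (if t \<in> A then Poly_Mapping.lookup p t else 0)"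
proof -
  have "Poly_Mapping.lookup (restrict_keys A p) t =
      (\<Sum>s\<in>Poly_Mapping.keys p \<inter> A. if s = t then Poly_Mapping.lookup p t else 0)"
    by (simp add: restrict_keys_def lookup_sum lookup_single when_def cong: if_cong)
  also have "\<dots> = (if t \<in> A then Poly_Mapping.lookup p t else 0)"
    by (auto simp: in_keys_iff)
  finally show ?thesis .
qed

lemma restrict_keys_all: "Poly_Mapping.keys p \<subseteq> A \<Longrightarrow> restrict_keys A p = p"
  by (rule poly_mapping_eqI) (auto simp: lookup_restrict_keys in_keys_iff)

lemma keys_restrict_keys: "Poly_Mapping.keys (restrict_keys A p) = Poly_Mapping.keys p \<inter> A"
  by (auto simp: in_keys_iff lookup_restrict_keys split: if_splits)

definition queen_generators :: "nat \<Rightarrow> 'k::field mpoly set" where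
  "queen_generators n = {Var v ^ 2 | v. v \<in> vars n} \<union>
      {Var (XV s) * Var (YV t) | s t. s \<in> board n \<and> t \<in> board n \<and> queen_move s t}"

lemma Var_mult: "Var v * Var w = Poly_Mapping.single (Poly_Mapping.single v 1 + Poly_Mapping.single w 1) 1"
  by (simp add: Var_def mult_single)

lemma queen_generators_nonstandard: "queen_generators n \<subseteq> nonstandard_polys n"
proof -
  have "Var v ^ 2 \<in> nonstandard_polys n" if "v \<in> vars n" for v
    unfolding power2_eq_square Var_mult using that keys_add[of "Poly_Mapping.single v (1::nat)" "Poly_Mapping.single v 1"]
    by (auto simp: nonstandard_polys_def carrier_poly_ring standard_def lookup_add not_le intro!: exI[of _ v])
  moreover have "Var (XV s) * Var (YV t) \<in> nonstandard_polys n"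
    if "s \<in> board n" "t \<in> board n" "queen_move s t" for s t
  proof -
    let ?d = "Poly_Mapping.single (XV s) (1::nat) + Poly_Mapping.single (YV t) 1"
    have "XV s \<in> Poly_Mapping.keys ?d" "YV t \<in> Poly_Mapping.keys ?d"
      by (simp_all add: in_keys_iff lookup_add)
    then have "\<not> standard ?d"
      using that(3) unfolding standard_def by blast
    moreover have "Poly_Mapping.keys ?d \<subseteq> vars n"
      using that keys_add[of "Poly_Mapping.single (XV s) (1::nat)" "Poly_Mapping.single (YV t) 1"]
      by (auto simp: vars_def)
    ultimately show ?thesis
      unfolding Var_mult by (simp add: nonstandard_polys_def carrier_poly_ring)
  qed
  ultimately show ?thesis by (auto simp: queen_generators_def)
qed

lemma monomial_eq_divisor_plus_quotient:
  assumes "\<And>v. Poly_Mapping.lookup d v \<le> Poly_Mapping.lookup t v"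
  shows "(t::monomial) = d + (t - d)"
  by (rule poly_mapping_eqI) (use assms in \<open>simp add: lookup_add lookup_minus\<close>)

text \<open>The nonstandard polynomials form an ideal that contains the generators. Conversely every
  nonstandard monomial is a multiple of a generator: of the square of a variable if an exponent is
  at least 2, and of some \<open>x\<^sub>r y\<^sub>s\<close> with a queen move from \<open>r\<close> to \<open>s\<close> otherwise. A polynomial is the
  sum of its terms, so nonstandard polynomials are in the queen ideal.\<close>

lemma queen_ideal_eq: "queen_ideal n = (nonstandard_polys n :: 'k::field mpoly set)"
proof
  interpret ring "poly_ring n :: 'k mpoly ring" by (rule ring_poly_ring)
  have Idl: "queen_ideal n = Idl\<^bsub>poly_ring n\<^esub> (queen_generators n :: 'k mpoly set)"
    by (simp add: queen_ideal_def queen_generators_def)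
  show "queen_ideal n \<subseteq> (nonstandard_polys n :: 'k mpoly set)"
    unfolding Idl by (rule genideal_minimal[OF ideal_nonstandard_polys queen_generators_nonstandard])
  have gen: "queen_generators n \<subseteq> carrier (poly_ring n :: 'k mpoly ring)"
    using queen_generators_nonstandard by (auto simp: nonstandard_polys_def)
  then interpret I: ideal "queen_ideal n" "poly_ring n :: 'k mpoly ring"
    unfolding Idl by (rule genideal_ideal)
  have gen_I: "g \<in> queen_ideal n" if "g \<in> queen_generators n" for g :: "'k mpoly"
    using genideal_self[OF gen] that by (auto simp: Idl)
  have single_I: "Poly_Mapping.single t c \<in> queen_ideal n"
    if t: "Poly_Mapping.keys t \<subseteq> vars n" "\<not> standard t" for t and c :: 'k
  proof -
    have "\<exists>d. Poly_Mapping.single d (1::'k) \<in> queen_generators n \<and>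
        (\<forall>v. Poly_Mapping.lookup d v \<le> Poly_Mapping.lookup t v)"
    proof (cases "\<forall>v. Poly_Mapping.lookup t v \<le> 1")
      case True
      then obtain r s where rs: "XV r \<in> Poly_Mapping.keys t" "YV s \<in> Poly_Mapping.keys t" "queen_move r s"
        using t(2) by (auto simp: standard_def)
      have "r \<in> board n" "s \<in> board n"
        using rs t(1) by (auto simp: vars_def)
      then have "Poly_Mapping.single (Poly_Mapping.single (XV r) 1 + Poly_Mapping.single (YV s) 1) (1::'k) \<in> queen_generators n"
        unfolding Var_mult[symmetric] queen_generators_def using rs by blast
      moreover have "Poly_Mapping.lookup (Poly_Mapping.single (XV r) 1 + Poly_Mapping.single (YV s) 1) v
          \<le> Poly_Mapping.lookup t v" for v
        using rs by (auto simp: lookup_add lookup_single when_def in_keys_iff Suc_le_eq)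
      ultimately show ?thesis by blast
    next
      case False
      then obtain v where v: "2 \<le> Poly_Mapping.lookup t v"
        by (auto simp: not_le Suc_le_eq numeral_2_eq_2)
      then have "v \<in> vars n"
        using t(1) by (auto simp: in_keys_iff)
      then have "Poly_Mapping.single (Poly_Mapping.single v 1 + Poly_Mapping.single v 1) (1::'k) \<in> queen_generators n"
        unfolding Var_mult[symmetric] power2_eq_square[symmetric] by (auto simp: queen_generators_def)
      moreover have "Poly_Mapping.lookup (Poly_Mapping.single v 1 + Poly_Mapping.single v 1) w
          \<le> Poly_Mapping.lookup t w" for w
        using v by (auto simp: lookup_add lookup_single when_def)
      ultimately show ?thesis by blast
    qed
    then obtain d where d: "Poly_Mapping.single d (1::'k) \<in> queen_generators n"
      and le: "\<And>v. Poly_Mapping.lookup d v \<le> Poly_Mapping.lookup t v" by blast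
    have "Poly_Mapping.single (t - d) c \<in> carrier (poly_ring n)"
      using t(1) by (auto simp: carrier_poly_ring in_keys_iff lookup_minus split: if_splits)
    then have "Poly_Mapping.single d 1 * Poly_Mapping.single (t - d) c \<in> queen_ideal n"
      using I.I_r_closed[OF gen_I[OF d]] by simp
    then show ?thesis
      using monomial_eq_divisor_plus_quotient[OF le] by (simp add: mult_single)
  qed
  show "nonstandard_polys n \<subseteq> (queen_ideal n :: 'k mpoly set)"
  proof
    fix p :: "'k mpoly" assume p: "p \<in> nonstandard_polys n"
    have "(\<Sum>t\<in>T. Poly_Mapping.single t (Poly_Mapping.lookup p t)) \<in> queen_ideal n"
      if "T \<subseteq> Poly_Mapping.keys p" for T
      using finite_subset[OF that finite_keys] that
    proof (induction T rule: finite_induct)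
      case empty
      then show ?case using I.zero_closed by simp
    next
      case (insert t T)
      then have "Poly_Mapping.single t (Poly_Mapping.lookup p t) \<in> queen_ideal n"
        using p by (intro single_I) (auto simp: nonstandard_polys_def carrier_poly_ring)
      with insert show ?case using I.a_closed by fastforce
    qed
    from this[of "Poly_Mapping.keys p"] show "p \<in> queen_ideal n"
      using restrict_keys_all[of p UNIV] by (simp add: restrict_keys_def)
  qed
qed


section \<open>The Hilbert function counts standard monomials\<close>

lemma ideal_queen_ideal: "ideal (queen_ideal n) (poly_ring n :: 'k::field mpoly ring)"
  unfolding queen_ideal_eq by (rule ideal_nonstandard_polys)

lemma residue_hom: "ring_hom_ring (poly_ring n :: 'k::field mpoly ring) (queen_quot n) (residue n)"
  using ideal.rcos_ring_hom_ring[OF ideal_queen_ideal]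
  by (simp add: queen_quot_def residue_def[abs_def])

text \<open>The membership test for the queen ideal as a congruence test: two polynomials agree in the
  quotient unless they differ in a standard monomial.\<close>

lemma residue_eq_iff:
  fixes p q :: "'k::field mpoly"
  assumes "p \<in> carrier (poly_ring n)" "q \<in> carrier (poly_ring n)"
  shows "residue n p = residue n q \<longleftrightarrow> (\<forall>t\<in>Poly_Mapping.keys (p - q). \<not> standard t)"
proof -
  interpret ring "poly_ring n :: 'k mpoly ring" by (rule ring_poly_ring)
  have "p \<ominus>\<^bsub>poly_ring n\<^esub> q = p - q"
    using assms by (simp add: a_minus_def poly_ring_a_inv)
  moreover have "p - q \<in> carrier (poly_ring n)"
    using poly_ring_add_closed[OF assms(1) poly_ring_uminus_closed[OF assms(2)]] by simp
  ultimately show ?thesis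
    unfolding residue_def quotient_eq_iff_same_a_r_cos[OF ideal_queen_ideal assms, symmetric]
    by (simp add: queen_ideal_eq nonstandard_polys_def)
qed

lemma subfield_residue_Const:
  "subfield (range (\<lambda>c :: 'k::field. residue n (Const c))) (queen_quot n)"
proof -
  interpret ring_hom_ring "poly_ring n :: 'k mpoly ring" "queen_quot n" "residue n"
    by (rule residue_hom)
  have "residue n 1 \<noteq> residue n (0 :: 'k mpoly)"
    using residue_eq_iff[of 1 n "0 :: 'k mpoly"] by (simp add: carrier_poly_ring standard_zero)
  then have "\<one>\<^bsub>queen_quot n\<^esub> \<noteq> (\<zero>\<^bsub>queen_quot n\<^esub> :: 'k mpoly set)"
    using hom_one hom_zero by simp
  from img_is_subfield(2)[OF subfield_Const this] show ?thesis
    by (simp add: image_image)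
qed

text \<open>Extending the span by one more monomial \<open>t\<close> adds the classes of the multiples \<open>c t\<close>, since
  the scalar \<open>c\<close> acts as the class of the constant polynomial \<open>c\<close>.\<close>

lemma Span_residue_monomials:
  assumes "\<forall>t\<in>set ts. Poly_Mapping.keys t \<subseteq> vars n"
  shows "ring.Span (queen_quot n) (range (\<lambda>c :: 'k::field. residue n (Const c)))
      (map (\<lambda>t. residue n (Poly_Mapping.single t 1)) ts) =
    residue n ` {p. Poly_Mapping.keys p \<subseteq> set ts}"
proof -
  interpret ring_hom_ring "poly_ring n :: 'k mpoly ring" "queen_quot n" "residue n"
    by (rule residue_hom)
  let ?K = "range (\<lambda>c :: 'k::field. residue n (Const c))"
  let ?m = "\<lambda>t. residue n (Poly_Mapping.single t (1::'k))"
  show ?thesis using assms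
  proof (induction ts)
    case Nil
    then show ?case using hom_zero by simp
  next
    case (Cons t ts)
    have carr: "p \<in> carrier (poly_ring n)" if "Poly_Mapping.keys p \<subseteq> set (t # ts)" for p :: "'k mpoly"
      using that Cons.prems by (auto simp: carrier_poly_ring)
    have t: "Poly_Mapping.single t c \<in> carrier (poly_ring n)" for c :: 'k
      using Cons.prems by (auto simp: carrier_poly_ring)
    have scaled: "residue n (Const c) \<otimes>\<^bsub>queen_quot n\<^esub> ?m t \<oplus>\<^bsub>queen_quot n\<^esub> residue n p =
        residue n (Poly_Mapping.single t c + p)" if "Poly_Mapping.keys p \<subseteq> set ts" for p c
    proof -
      have "p \<in> carrier (poly_ring n)" using carr that by auto
      moreover have "residue n (Const c) \<otimes>\<^bsub>queen_quot n\<^esub> ?m t = residue n (Const c * Poly_Mapping.single t 1)"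
        using hom_mult[OF Const_carrier t] by simp
      moreover have "Const c * Poly_Mapping.single t (1::'k) = Poly_Mapping.single t c"
        by (simp add: Const_def mult_single)
      ultimately show ?thesis
        using hom_add[OF t, of p c] by simp
    qed
    have Span: "S.Span ?K (map ?m (t # ts)) =
        (\<Union>c. (\<lambda>p. residue n (Poly_Mapping.single t c + p)) ` {p. Poly_Mapping.keys p \<subseteq> set ts})"
    proof -
      have "S.Span ?K (map ?m (t # ts)) =
          S.line_extension ?K (?m t) (residue n ` {p. Poly_Mapping.keys p \<subseteq> set ts})"
        using Cons by simp
      also have "\<dots> = (\<Union>c. (\<lambda>p. residue n (Const c) \<otimes>\<^bsub>queen_quot n\<^esub> ?m t \<oplus>\<^bsub>queen_quot n\<^esub> residue n p) `
          {p. Poly_Mapping.keys p \<subseteq> set ts})"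
        unfolding S.line_extension_mem_iff set_eq_iff by blast
      also have "\<dots> = (\<Union>c. (\<lambda>p. residue n (Poly_Mapping.single t c + p)) ` {p. Poly_Mapping.keys p \<subseteq> set ts})"
        by (intro SUP_cong image_cong refl) (simp add: scaled)
      finally show ?thesis .
    qed
    also have "\<dots> = residue n ` {p. Poly_Mapping.keys p \<subseteq> set (t # ts)}"
    proof (intro equalityI subsetI)
      fix x :: "'k mpoly set"
      assume "x \<in> (\<Union>c. (\<lambda>p. residue n (Poly_Mapping.single t c + p)) ` {p. Poly_Mapping.keys p \<subseteq> set ts})"
      then obtain c p where x: "x = residue n (Poly_Mapping.single t c + p)" "Poly_Mapping.keys p \<subseteq> set ts"
        by blast
      have "Poly_Mapping.keys (Poly_Mapping.single t c + p) \<subseteq> set (t # ts)"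
        using x(2) keys_add[of "Poly_Mapping.single t c" p] by (auto split: if_splits)
      then show "x \<in> residue n ` {p. Poly_Mapping.keys p \<subseteq> set (t # ts)}"
        using x(1) by blast
    next
      fix x :: "'k mpoly set"
      assume "x \<in> residue n ` {p. Poly_Mapping.keys p \<subseteq> set (t # ts)}"
      then obtain p where p: "x = residue n p" "Poly_Mapping.keys p \<subseteq> set (t # ts)" by blast
      have "p = Poly_Mapping.single t (Poly_Mapping.lookup p t) + restrict_keys (- {t}) p"
        by (rule poly_mapping_eqI) (auto simp: lookup_add lookup_single when_def lookup_restrict_keys)
      then have "x = residue n (Poly_Mapping.single t (Poly_Mapping.lookup p t) + restrict_keys (- {t}) p)"
        using p(1) by simp
      moreover have "Poly_Mapping.keys (restrict_keys (- {t}) p) \<subseteq> set ts"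
        using p by (auto simp: keys_restrict_keys)
      ultimately show "x \<in> (\<Union>c. (\<lambda>p. residue n (Poly_Mapping.single t c + p)) ` {p. Poly_Mapping.keys p \<subseteq> set ts})"
        by blast
    qed
    finally show ?case .
  qed
qed

text \<open>If the class of \<open>t\<close> were in the span of the other classes, then \<open>t - p\<close> would be in the ideal
  for a polynomial \<open>p\<close> without the monomial \<open>t\<close>; but \<open>t\<close> is then a standard monomial of
  \<open>t - p\<close>.\<close>

lemma independent_residue_monomials:
  assumes "\<forall>t\<in>set ts. Poly_Mapping.keys t \<subseteq> vars n" "\<forall>t\<in>set ts. standard t" "distinct ts"
  shows "ring.independent (queen_quot n) (range (\<lambda>c :: 'k::field. residue n (Const c)))
      (map (\<lambda>t. residue n (Poly_Mapping.single t 1)) ts)"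
proof -
  interpret ring_hom_ring "poly_ring n :: 'k mpoly ring" "queen_quot n" "residue n"
    by (rule residue_hom)
  show ?thesis using assms
  proof (induction ts)
    case Nil
    then show ?case by simp
  next
    case (Cons t ts)
    let ?t = "Poly_Mapping.single t (1::'k)"
    have t: "?t \<in> carrier (poly_ring n)"
      using Cons.prems by (auto simp: carrier_poly_ring)
    have "residue n ?t \<noteq> residue n p" if p: "Poly_Mapping.keys p \<subseteq> set ts" for p
    proof -
      have "p \<in> carrier (poly_ring n)"
        using p Cons.prems by (auto simp: carrier_poly_ring)
      moreover have "t \<notin> Poly_Mapping.keys p" using p Cons.prems by auto
      then have "t \<in> Poly_Mapping.keys (?t - p)"
        by (simp add: in_keys_iff lookup_minus)
      ultimately show ?thesis
        using residue_eq_iff[OF t] Cons.prems(2) by auto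
    qed
    then have "residue n ?t \<notin> S.Span (range (\<lambda>c :: 'k. residue n (Const c)))
        (map (\<lambda>t. residue n (Poly_Mapping.single t 1)) ts)"
      using Cons.prems(1) by (subst Span_residue_monomials) auto
    moreover have "residue n ?t \<in> carrier (queen_quot n)"
      using t by simp
    ultimately show ?case
      using Cons by (simp del: S.Span.simps add: S.independent.li_Cons)
  qed
qed

definition standard_monomials :: "nat \<Rightarrow> nat \<Rightarrow> nat \<Rightarrow> monomial set" where
  "standard_monomials n a b =
     {t. Poly_Mapping.keys t \<subseteq> vars n \<and> standard t \<and> bidegree n t = (a, b)}"

text \<open>Discarding the nonstandard terms of a homogeneous polynomial changes neither its class nor
  its bidegree, so the graded component is spanned by the standard monomials.\<close>

lemma residue_homogeneous:
  "residue n ` homogeneous n (a, b) =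
   (residue n ` {p. Poly_Mapping.keys p \<subseteq> standard_monomials n a b} :: 'k::field mpoly set set)"
proof
  show "(residue n ` {p. Poly_Mapping.keys p \<subseteq> standard_monomials n a b} :: 'k mpoly set set)
      \<subseteq> residue n ` homogeneous n (a, b)"
    by (rule image_mono) (auto simp: homogeneous_def standard_monomials_def carrier_poly_ring)
  show "residue n ` homogeneous n (a, b)
      \<subseteq> (residue n ` {p. Poly_Mapping.keys p \<subseteq> standard_monomials n a b} :: 'k mpoly set set)"
  proof
    fix x :: "'k mpoly set" assume "x \<in> residue n ` homogeneous n (a, b)"
    then obtain p where p: "x = residue n p" "p \<in> homogeneous n (a, b)" by blast
    let ?q = "restrict_keys {t. standard t} p"
    have q: "Poly_Mapping.keys ?q \<subseteq> standard_monomials n a b"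
      using p(2) by (auto simp: keys_restrict_keys homogeneous_def standard_monomials_def carrier_poly_ring)
    have "residue n p = residue n ?q"
    proof (subst residue_eq_iff)
      show "p \<in> carrier (poly_ring n)" using p by (simp add: homogeneous_def)
      show "?q \<in> carrier (poly_ring n)" using q by (auto simp: carrier_poly_ring standard_monomials_def)
      show "\<forall>t\<in>Poly_Mapping.keys (p - ?q). \<not> standard t"
        by (auto simp: in_keys_iff lookup_minus lookup_restrict_keys)
    qed
    with p(1) q show "x \<in> residue n ` {p. Poly_Mapping.keys p \<subseteq> standard_monomials n a b}" by blast
  qed
qed

text \<open>The classes of the standard monomials are a basis of the graded component. Finiteness allows
  to list them; it follows below from the description of these monomials by sets of squares.\<close>

lemma HF_eq_card_if_finite:
  assumes "finite (standard_monomials n a b)"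
  shows "HF TYPE('k::field) n a b = card (standard_monomials n a b)"
proof -
  interpret ring_hom_ring "poly_ring n :: 'k mpoly ring" "queen_quot n" "residue n"
    by (rule residue_hom)
  obtain ts where ts: "set ts = standard_monomials n a b" "distinct ts"
    using finite_distinct_list[OF assms] by blast
  let ?K = "range (\<lambda>c :: 'k::field. residue n (Const c))"
  let ?us = "map (\<lambda>t. residue n (Poly_Mapping.single t (1::'k))) ts"
  have vars: "\<forall>t\<in>set ts. Poly_Mapping.keys t \<subseteq> vars n" and std: "\<forall>t\<in>set ts. standard t"
    by (auto simp: ts standard_monomials_def)
  have "S.dimension (length ?us) ?K (S.Span ?K ?us)"
    by (rule S.dimension_independent, rule independent_residue_monomials[OF vars std ts(2)])
  then have "S.dim ?K (S.Span ?K ?us) = length ?us"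
    using S.dimI[OF subfield_residue_Const] unfolding over_def by blast
  also have "\<dots> = card (standard_monomials n a b)"
    using distinct_card[OF ts(2)] by (simp add: ts(1))
  finally show ?thesis
    unfolding HF_def residue_homogeneous Span_residue_monomials[OF vars] ts(1) .
qed


section \<open>Standard monomials are placements with marked unattacked squares\<close>

definition support_monomial :: "square set \<times> square set \<Rightarrow> monomial" where
  "support_monomial = (\<lambda>(Q, U). \<Sum>v\<in>XV ` Q \<union> YV ` U. Poly_Mapping.single v 1)"

lemma finite_board: "finite (board n)" and card_board: "card (board n) = n ^ 2"
  by (simp_all add: board_def power2_eq_square)

lemma lookup_support_monomial:
  assumes "finite Q" "finite U"
  shows "Poly_Mapping.lookup (support_monomial (Q, U)) v = (if v \<in> XV ` Q \<union> YV ` U then 1 else 0)"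
  using assms by (simp add: support_monomial_def lookup_sum lookup_single when_def)

lemma keys_support_monomial:
  assumes "finite Q" "finite U"
  shows "Poly_Mapping.keys (support_monomial (Q, U)) = XV ` Q \<union> YV ` U"
  using assms by (auto simp: in_keys_iff lookup_support_monomial split: if_splits)

lemma lookup_zero_one:
  assumes "\<And>v. Poly_Mapping.lookup (t::monomial) v \<le> 1"
  shows "Poly_Mapping.lookup t v = (if v \<in> Poly_Mapping.keys t then 1 else 0)"
  using assms[of v] by (auto simp: in_keys_iff)

lemma bidegree_zero_one:
  assumes "\<And>v. Poly_Mapping.lookup t v \<le> 1"
  shows "bidegree n t = (card {s \<in> board n. XV s \<in> Poly_Mapping.keys t},
                         card {s \<in> board n. YV s \<in> Poly_Mapping.keys t})"
proof -
  have sum: "(\<Sum>s\<in>board n. Poly_Mapping.lookup t (f s)) = card {s \<in> board n. f s \<in> Poly_Mapping.keys t}" for f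
    by (subst lookup_zero_one[OF assms]) (simp add: finite_board flip: sum.inter_filter)
  show ?thesis unfolding bidegree_def sum ..
qed

text \<open>The inverse map reads the sets \<open>Q\<close> and \<open>U\<close> off the variables of a monomial. As exponents in
  standard monomials are at most 1, the variables determine the monomial, and the bidegree is
  the pair of the sizes of \<open>Q\<close> and \<open>U\<close>.\<close>

lemma support_monomial_bij:
  "bij_betw support_monomial
     (SIGMA Q:{Q. Q \<subseteq> board n \<and> card Q = k}. {U. U \<subseteq> unattacked n Q \<and> card U = u})
     (standard_monomials n k u)"
proof (rule bij_betw_byWitness[where
      f' = "\<lambda>t. ({s \<in> board n. XV s \<in> Poly_Mapping.keys t}, {s \<in> board n. YV s \<in> Poly_Mapping.keys t})"],
    goal_cases)
  case 1
  show ?case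
  proof
    fix x assume x: "x \<in> (SIGMA Q:{Q. Q \<subseteq> board n \<and> card Q = k}. {U. U \<subseteq> unattacked n Q \<and> card U = u})"
    then obtain Q U where "x = (Q, U)" and *: "Q \<subseteq> board n" "U \<subseteq> unattacked n Q"
      by blast
    from * have "U \<subseteq> board n" by (auto simp: unattacked_def)
    with * have "finite Q" "finite U" using finite_board finite_subset by blast+
    with * \<open>U \<subseteq> board n\<close>
    show "({s \<in> board n. XV s \<in> Poly_Mapping.keys (support_monomial x)},
      {s \<in> board n. YV s \<in> Poly_Mapping.keys (support_monomial x)}) = x"
      unfolding \<open>x = (Q, U)\<close> by (auto simp: keys_support_monomial)
  qed
next
  case 2
  show ?case
  proof
    fix t assume t: "t \<in> standard_monomials n k u"
    let ?Q = "{s \<in> board n. XV s \<in> Poly_Mapping.keys t}"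
    let ?U = "{s \<in> board n. YV s \<in> Poly_Mapping.keys t}"
    have "Poly_Mapping.keys t \<subseteq> vars n" and le: "Poly_Mapping.lookup t v \<le> 1" for v
      using t by (auto simp: standard_monomials_def standard_def)
    then have "v \<in> XV ` ?Q \<union> YV ` ?U \<longleftrightarrow> v \<in> Poly_Mapping.keys t" for v
      by (auto simp: vars_def)
    then have "Poly_Mapping.lookup (support_monomial (?Q, ?U)) v = Poly_Mapping.lookup t v" for v
      using lookup_zero_one[OF le, of v] by (subst lookup_support_monomial) (simp_all add: finite_board)
    then show "support_monomial (?Q, ?U) = t"
      by (rule poly_mapping_eqI)
  qed
next
  case 3
  show ?case
  proof safe
    fix Q U assume *: "Q \<subseteq> board n" "U \<subseteq> unattacked n Q" "k = card Q" "u = card U"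
    then have U: "U \<subseteq> board n" by (auto simp: unattacked_def)
    with * have fin: "finite Q" "finite U" using finite_board finite_subset by blast+
    have "{s \<in> board n. XV s \<in> XV ` Q \<union> YV ` U} = Q" "{s \<in> board n. YV s \<in> XV ` Q \<union> YV ` U} = U"
      using * U by auto
    then show "support_monomial (Q, U) \<in> standard_monomials n (card Q) (card U)"
      using * U fin bidegree_zero_one[of "support_monomial (Q, U)" n]
      by (auto simp: standard_monomials_def standard_def lookup_support_monomial
          keys_support_monomial vars_def unattacked_def)
  qed
next
  case 4
  show ?case
  proof safe
    fix t assume t: "t \<in> standard_monomials n k u"
    then have "bidegree n t = (k, u)" "standard t"
      by (auto simp: standard_monomials_def)
    then show "card {s \<in> board n. XV s \<in> Poly_Mapping.keys t} = k"
      and "card {s \<in> board n. YV s \<in> Poly_Mapping.keys t} = u"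
      using bidegree_zero_one[of t n] by (auto simp: standard_def)
    fix r assume "r \<in> board n" "YV r \<in> Poly_Mapping.keys t"
    then show "r \<in> unattacked n {s \<in> board n. XV s \<in> Poly_Mapping.keys t}"
      using \<open>standard t\<close> unfolding unattacked_def standard_def by blast
  qed
qed

lemma unattacked_board: "unattacked n Q \<subseteq> board n"
  by (auto simp: unattacked_def)

lemma finite_unattacked: "finite (unattacked n Q)"
  using finite_subset[OF unattacked_board finite_board] .

lemma card_unattacked_le: "card (unattacked n Q) \<le> n\<^sup>2"
  using card_mono[OF finite_board unattacked_board] by (simp add: card_board)

lemma HF_eq_sum_placements:
  "HF TYPE('k::field) n k u = (\<Sum>Q | Q \<subseteq> board n \<and> card Q = k. card (unattacked n Q) choose u)"
proof -
  let ?S = "SIGMA Q:{Q. Q \<subseteq> board n \<and> card Q = k}. {U. U \<subseteq> unattacked n Q \<and> card U = u}"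
  have fin: "finite {Q. Q \<subseteq> board n \<and> card Q = k}" by (simp add: finite_board)
  have "finite ?S"
    using fin by (intro finite_SigmaI) (simp_all add: finite_unattacked)
  then have "HF TYPE('k) n k u = card (standard_monomials n k u)"
    using bij_betw_finite[OF support_monomial_bij] by (intro HF_eq_card_if_finite) blast
  also have "\<dots> = card ?S"
    using bij_betw_same_card[OF support_monomial_bij] by metis
  also have "\<dots> = (\<Sum>Q | Q \<subseteq> board n \<and> card Q = k. card (unattacked n Q) choose u)"
    using fin by (simp add: card_SigmaI finite_unattacked n_subsets)
  finally show ?thesis .
qed


section \<open>Inverting the counts\<close>

lemma HF_eq_sum_Phi:
  "HF TYPE('k::field) n k u = (\<Sum>v\<le>n\<^sup>2. (v choose u) * Phi n k v)"
proof -
  let ?P = "{Q. Q \<subseteq> board n \<and> card Q = k}"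
  have fin: "finite ?P" by (simp add: finite_board)
  have "HF TYPE('k) n k u =
      (\<Sum>v\<le>n\<^sup>2. \<Sum>Q | Q \<in> ?P \<and> card (unattacked n Q) = v. card (unattacked n Q) choose u)"
    unfolding HF_eq_sum_placements
    by (rule sum.group[symmetric, OF fin]) (auto simp: card_unattacked_le)
  also have "\<dots> = (\<Sum>v\<le>n\<^sup>2. (v choose u) * Phi n k v)"
    by (intro sum.cong refl) (simp add: Phi_def mult.commute conj_assoc)
  finally show ?thesis .
qed

lemma Phi_eq_0_above_square:
  assumes "n\<^sup>2 < v"
  shows "Phi n k v = 0"
proof -
  have "card (unattacked n Q) \<noteq> v" for Q
    using card_unattacked_le[of n Q] assms by linarith
  then show ?thesis by (simp add: Phi_def)
qed

text \<open>The summand for \<open>w = v\<close> in \<open>HF(k, v) = \<Sum>\<^sub>w (w choose v) \<Phi>(k, w)\<close> is \<open>\<Phi>(k, v)\<close>, so if the latter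
  is positive then \<open>v\<close> is among the degrees whose maximum is \<open>\<mu>(k)\<close>. That maximum of a set of
  naturals dominates \<open>v\<close> only because the set is finite: it is bounded by the size of the board.\<close>

lemma Phi_eq_0_above_mu:
  assumes "mu TYPE('k::field) n k < v"
  shows "Phi n k v = 0"
proof (rule ccontr)
  assume "Phi n k v \<noteq> 0"
  then have "v \<le> n\<^sup>2"
    using Phi_eq_0_above_square by (metis not_le)
  with \<open>Phi n k v \<noteq> 0\<close> have "HF TYPE('k) n k v > 0"
    unfolding HF_eq_sum_Phi by (intro sum_pos2[of _ v]) auto
  moreover have "HF TYPE('k) n k m = 0" if "n\<^sup>2 < m" for m
    using that by (simp add: HF_eq_sum_Phi binomial_eq_0)
  then have "{m. HF TYPE('k) n k m > 0} \<subseteq> {..n\<^sup>2}"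
    by (auto intro: leI)
  then have "finite {m. HF TYPE('k) n k m > 0}"
    using finite_subset by blast
  ultimately have "v \<le> mu TYPE('k) n k"
    unfolding mu_def by (intro Max_ge) auto
  with assms show False by simp
qed

theorem proposition2p2:
  fixes n k u :: nat
  assumes "n \<ge> 1" and "1 \<le> k" and "k \<le> n ^ 2"
    and "u \<le> mu TYPE('k::field) n k"
  shows "int (Phi n k u) =
    int (HF TYPE('k) n k u)
      - (\<Sum>v = u + 1..mu TYPE('k) n k. int (v choose u) * int (Phi n k v))"
proof -
  let ?m = "mu TYPE('k) n k"
  have "HF TYPE('k) n k u = (\<Sum>v\<le>n\<^sup>2. (v choose u) * Phi n k v)"
    by (rule HF_eq_sum_Phi)
  \<comment> \<open>The ranges up to \<open>n\<^sup>2\<close> and up to \<open>\<mu>(k)\<close> are compared inside a common larger range.\<close>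
  also have "\<dots> = (\<Sum>v\<le>max (n\<^sup>2) ?m. (v choose u) * Phi n k v)"
    by (intro sum.mono_neutral_left) (auto simp: Phi_eq_0_above_square not_le)
  also have "\<dots> = (\<Sum>v = u..?m. (v choose u) * Phi n k v)"
    by (intro sum.mono_neutral_right)
      (auto simp: not_le binomial_eq_0 Phi_eq_0_above_mu[where 'k = 'k])
  also have "\<dots> = Phi n k u + (\<Sum>v = u + 1..?m. (v choose u) * Phi n k v)"
    using assms(4) by (simp add: sum.atLeast_Suc_atMost)
  finally show ?thesis by simp
qed

end
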